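(* For any real-valued random variable $X$ with characteristic function $f$, any real $x$, and any $m\in\{0,1,\dots\}$, $$\mathsf{P}(X<x)+\tfrac12\mathsf{P}(X=x)=\frac12-\frac{(-1)^m}{2\pi i\binom{2m}{m}}\int_0^{\infty-}(\Delta_t^{2m+1} f_x)(0)\,\frac{dt}t,$$ where $f_x$ stands for the characteristic function of the random variable $X-x$, so that $f_x(t)=e^{-itx}f(t)$ for all real $x$ and $t$.
   Context: $\int_0^{\infty-}:=\lim_{T\uparrow\infty}\int_0^T$. Any claim about an integral $\int_a^b$ with $0\le a<b\le\infty$ includes by default the statement that the integral exists in the Lebesgue sense and is finite. $\Delta_v$ is the symmetric difference operator $(\Delta_v\psi)(z):=\psi(z+v)-\psi(z-v)$, and $\Delta_v^n$ is its $n$th power, so that $(\Delta_v^n\psi)(z)=\sum_{j=0}^n(-1)^j\binom nj\psi(z+(n-2j)v)$.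
   Formalization: The integral from 0 to T is taken as the limit, as ε decreases to 0, of the Lebesgue integrals from ε to T, since for some very heavy-tailed X the integrand is not Lebesgue integrable near 0; where it is integrable, the two readings agree. *)

theory Defs
  imports "HOL-Probability.Probability"
begin

definition sym_diff_op :: "'a \<Rightarrow> ('a \<Rightarrow> 'b) \<Rightarrow> 'a::ab_group_add \<Rightarrow> 'b::ab_group_add"
  where "sym_diff_op v \<psi> = (\<lambda>z. \<psi> (z + v) - \<psi> (z - v))"

text \<open>
  The integral from \<open>0\<close> to \<open>\<infinity>-\<close> is the limit of the integrals over \<open>(0,T]\<close> as \<open>T\<close> tends to infinity.
  The integral over \<open>(0,T]\<close> is itself understood as the limit of Lebesgue integrals over \<open>[\<epsilon>,T]\<close>
  as \<open>\<epsilon>\<close> tends to \<open>0\<close> from the right: integrands of the form \<open>E sin(tX)/t\<close> need not be absolutely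
  integrable near \<open>0\<close> when \<open>E ln(1 + |X|)\<close> is infinite. If the integrand is Lebesgue integrable on
  every \<open>(0,T]\<close>, this is the limit of the Lebesgue integrals over \<open>(0,T]\<close>; see the lemma below.
\<close>

definition has_integral_0_inf_minus :: "(real \<Rightarrow> complex) \<Rightarrow> complex \<Rightarrow> bool"
  where "has_integral_0_inf_minus g I \<longleftrightarrow>
    (\<forall>\<epsilon> T. 0 < \<epsilon> \<and> \<epsilon> \<le> T \<longrightarrow> set_integrable lborel {\<epsilon>..T} g) \<and>
    (\<exists>G. (\<forall>T>0. ((\<lambda>\<epsilon>. LBINT t:{\<epsilon>..T}. g t) \<longlongrightarrow> G T) (at_right 0)) \<and> (G \<longlongrightarrow> I) at_top)"

lemma has_integral_0_inf_minus_iff: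
  assumes "\<And>T. T > 0 \<Longrightarrow> set_integrable lborel {0<..T} g"
  shows "has_integral_0_inf_minus g I \<longleftrightarrow> ((\<lambda>T. LBINT t:{0<..T}. g t) \<longlongrightarrow> I) at_top"
proof -
  have lim: "((\<lambda>\<epsilon>. LBINT t:{\<epsilon>..T}. g t) \<longlongrightarrow> (LBINT t:{0<..T}. g t)) (at_right 0)" if "T > 0" for T
    using that assms by (intro tendsto_set_lebesgue_integral_at_right) auto
  have int: "set_integrable lborel {\<epsilon>..T} g" if "0 < \<epsilon>" "\<epsilon> \<le> T" for \<epsilon> T
    by (rule set_integrable_subset[OF assms[of T]]) (use that in auto)
  show ?thesis
  proof
    assume "has_integral_0_inf_minus g I"
    then obtain G where G: "\<And>T. T > 0 \<Longrightarrow> ((\<lambda>\<epsilon>. LBINT t:{\<epsilon>..T}. g t) \<longlongrightarrow> G T) (at_right 0)"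
      and GI: "(G \<longlongrightarrow> I) at_top"
      unfolding has_integral_0_inf_minus_def by blast
    have "G T = (LBINT t:{0<..T}. g t)" if "T > 0" for T
      by (rule tendsto_unique[OF _ G[OF that] lim[OF that]]) simp
    then have "\<forall>\<^sub>F T in at_top. G T = (LBINT t:{0<..T}. g t)"
      by (intro eventually_mono[OF eventually_gt_at_top[of "0::real"]])
    with GI show "((\<lambda>T. LBINT t:{0<..T}. g t) \<longlongrightarrow> I) at_top"
      by (rule Lim_transform_eventually)
  next
    assume "((\<lambda>T. LBINT t:{0<..T}. g t) \<longlongrightarrow> I) at_top"
    then show "has_integral_0_inf_minus g I"
      unfolding has_integral_0_inf_minus_def
      by (intro conjI exI[of _ "\<lambda>T. LBINT t:{0<..T}. g t"] allI impI lim int) auto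
  qed
qed

end

theory Submission
  imports Defs
begin

text \<open>
  With \<open>Y = X - x\<close> and \<open>n = 2 m + 1\<close>, pairing the \<open>j\<close>-th and the \<open>(n - j)\<close>-th terms gives
  \<open>(\<Delta>\<^sub>t\<^sup>n f\<^sub>x)(0) = 2 \<i> (\<Sum>j\<le>m. (-1)\<^sup>j (n choose j) E sin ((n - 2 j) t Y))\<close>. By Fubini, the integral of
  \<open>E sin (c t Y) / t\<close> over \<open>[\<epsilon>, T]\<close> is \<open>E Si (c T Y) - E Si (c \<epsilon> Y)\<close>, which by dominated
  convergence tends to \<open>\<pi>/2 E sgn Y\<close> for every \<open>c > 0\<close>. As the limit does not depend on \<open>c\<close>, only
  the alternating sum \<open>(\<Sum>j\<le>m. (-1)\<^sup>j (n choose j)) = (-1)\<^sup>m (2 m choose m)\<close> remains.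
\<close>

section \<open>Powers of the symmetric difference operator\<close>

lemma sym_diff_op_funpow:
  fixes \<psi> :: "real \<Rightarrow> complex"
  shows "(sym_diff_op v ^^ n) \<psi> z =
    (\<Sum>j\<le>n. (-1) ^ j * of_nat (n choose j) * \<psi> (z + (real n - 2 * real j) * v))"
proof (induction n arbitrary: z)
  case 0
  show ?case by simp
next
  case (Suc n)
  \<comment> \<open>The \<open>j\<close>-th term taken at \<open>z + v\<close> lands on point
    \<open>j\<close> of the grid for \<open>Suc n\<close>; taken at \<open>z - v\<close> it lands on
    point \<open>Suc j\<close>, and the minus sign of the difference supplies the missing factor -1.
    With point and sign absorbed in \<open>g\<close>, only Pascal's rule is left.\<close>
  define g where "g j = (-1) ^ j * \<psi> (z + (real (Suc n) - 2 * real j) * v)" for j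
  have "(sym_diff_op v ^^ Suc n) \<psi> z = (\<Sum>j\<le>n. of_nat (n choose j) * (g j + g (Suc j)))"
    by (simp add: sym_diff_op_def Suc.IH g_def sum_subtractf [symmetric] algebra_simps)
  also have "\<dots> = (\<Sum>j\<le>n. of_nat (n choose j) * g j) + (\<Sum>j\<le>n. of_nat (n choose j) * g (Suc j))"
    by (simp add: distrib_left sum.distrib)
  \<comment> \<open>The added term is zero since \<open>n choose Suc n = 0\<close>; once
    \<open>g 0\<close> is split off, both sums run over the same \<open>g (Suc j)\<close>.\<close>
  also have "(\<Sum>j\<le>n. of_nat (n choose j) * g j) = (\<Sum>j\<le>Suc n. of_nat (n choose j) * g j)"
    by simp
  also have "\<dots> = g 0 + (\<Sum>j\<le>n. of_nat (n choose Suc j) * g (Suc j))"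
    by (subst sum.atMost_Suc_shift) simp
  also have "\<dots> + (\<Sum>j\<le>n. of_nat (n choose j) * g (Suc j)) =
      (\<Sum>j\<le>Suc n. of_nat (Suc n choose j) * g j)"
    by (subst sum.atMost_Suc_shift) (simp add: distrib_right sum.distrib)
  finally show ?case
    by (simp add: g_def mult_ac)
qed

text \<open>For odd \<open>n\<close> the reflection of \<open>j\<close> to \<open>n - j\<close>
  keeps the binomial coefficient, flips the sign of \<open>(-1) ^ j\<close> and negates the
  argument. There is no middle term, so the upper half of the indices folds onto
  \<open>{..m}\<close>.\<close>

lemma sym_diff_op_funpow_odd:
  fixes \<psi> :: "real \<Rightarrow> complex"
  shows "(sym_diff_op v ^^ (2 * m + 1)) \<psi> 0 =
    (\<Sum>j\<le>m. (-1) ^ j * of_nat ((2 * m + 1) choose j) *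
      (\<psi> ((2 * (real m - real j) + 1) * v) - \<psi> (- ((2 * (real m - real j) + 1) * v))))"
proof -
  define n where "n = 2 * m + 1"
  define h where "h j = (-1) ^ j * of_nat (n choose j) * \<psi> ((real n - 2 * real j) * v)" for j
  have "(sym_diff_op v ^^ n) \<psi> 0 = (\<Sum>j\<le>n. h j)"
    by (simp add: sym_diff_op_funpow h_def)
  also have "{..n} = {..m} \<union> {Suc m..n}"
    by (auto simp: n_def)
  also have "(\<Sum>j\<in>\<dots>. h j) = (\<Sum>j\<le>m. h j) + (\<Sum>j=Suc m..n. h j)"
    by (intro sum.union_disjoint) auto
  also have "(\<Sum>j=Suc m..n. h j) = (\<Sum>j\<le>m. h (n - j))"
    by (rule sum.reindex_bij_witness[of _ "\<lambda>j. n - j" "\<lambda>j. n - j"]) (auto simp: n_def)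
  also have "(\<Sum>j\<le>m. h j) + \<dots> = (\<Sum>j\<le>m. h j + h (n - j))"
    by (simp add: sum.distrib)
  also have "\<dots> = (\<Sum>j\<le>m. (-1) ^ j * of_nat (n choose j) *
      (\<psi> ((2 * (real m - real j) + 1) * v) - \<psi> (- ((2 * (real m - real j) + 1) * v))))"
  proof (rule sum.cong)
    fix j assume "j \<in> {..m}"
    then have j: "j \<le> n" "j \<le> m" by (auto simp: n_def)
    have "n choose (n - j) = n choose j"
      using j by (simp flip: binomial_symmetric)
    moreover have "(-1) ^ (n - j) = - ((-1) ^ j :: complex)"
      using j by (cases "even j") (auto simp: n_def)
    moreover have "(real n - 2 * real (n - j)) * v = - ((2 * (real m - real j) + 1) * v)"
      using j by (simp add: n_def of_nat_diff algebra_simps)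
    moreover have "(real n - 2 * real j) * v = (2 * (real m - real j) + 1) * v"
      by (simp add: n_def algebra_simps)
    ultimately show "h j + h (n - j) = (-1) ^ j * of_nat (n choose j) *
      (\<psi> ((2 * (real m - real j) + 1) * v) - \<psi> (- ((2 * (real m - real j) + 1) * v)))"
      unfolding h_def by (simp only:) (simp add: algebra_simps)
  qed simp
  finally show ?thesis
    by (simp only: n_def)
qed

section \<open>Linearity of the improper integral\<close>

lemma has_integral_0_inf_minus_sum:
  assumes "\<And>j. j \<in> A \<Longrightarrow> has_integral_0_inf_minus (g j) (I j)"
  shows "has_integral_0_inf_minus (\<lambda>t. \<Sum>j\<in>A. c j * g j t) (\<Sum>j\<in>A. c j * I j)"
proof -
  have int: "set_integrable lborel {\<epsilon>..T} (g j)" if "j \<in> A" "0 < \<epsilon>" "\<epsilon> \<le> T" for j \<epsilon> T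
    using assms that unfolding has_integral_0_inf_minus_def by blast
  have "\<forall>j\<in>A. \<exists>G. (\<forall>T>0. ((\<lambda>\<epsilon>. LBINT t:{\<epsilon>..T}. g j t) \<longlongrightarrow> G T) (at_right 0)) \<and>
      (G \<longlongrightarrow> I j) at_top"
    using assms unfolding has_integral_0_inf_minus_def by blast
  then obtain G where
    G: "\<And>j T. j \<in> A \<Longrightarrow> T > 0 \<Longrightarrow> ((\<lambda>\<epsilon>. LBINT t:{\<epsilon>..T}. g j t) \<longlongrightarrow> G j T) (at_right 0)"
    and GI: "\<And>j. j \<in> A \<Longrightarrow> (G j \<longlongrightarrow> I j) at_top"
    by metis
  have ints: "set_integrable lborel {\<epsilon>..T} (\<lambda>t. \<Sum>j\<in>A. c j * g j t)" if "0 < \<epsilon>" "\<epsilon> \<le> T" for \<epsilon> T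
    using int that unfolding set_integrable_def
    by (simp add: scaleR_sum_right flip: mult_scaleR_right)
  have eq: "(LBINT t:{\<epsilon>..T}. \<Sum>j\<in>A. c j * g j t) = (\<Sum>j\<in>A. c j * (LBINT t:{\<epsilon>..T}. g j t))"
    if "0 < \<epsilon>" "\<epsilon> \<le> T" for \<epsilon> T
    using int that unfolding set_integrable_def set_lebesgue_integral_def
    by (simp add: scaleR_sum_right flip: mult_scaleR_right)
  have "((\<lambda>\<epsilon>. LBINT t:{\<epsilon>..T}. \<Sum>j\<in>A. c j * g j t) \<longlongrightarrow> (\<Sum>j\<in>A. c j * G j T)) (at_right 0)"
    if "T > 0" for T
  \<comment> \<open>The identity \<open>eq\<close> holds for \<open>\<epsilon> \<le> T\<close> only,
    which is eventually the case as \<open>\<epsilon>\<close> tends to 0.\<close>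
  proof (rule Lim_transform_eventually)
    show "((\<lambda>\<epsilon>. \<Sum>j\<in>A. c j * (LBINT t:{\<epsilon>..T}. g j t)) \<longlongrightarrow> (\<Sum>j\<in>A. c j * G j T)) (at_right 0)"
      by (intro tendsto_intros G that)
    show "\<forall>\<^sub>F \<epsilon> in at_right 0. (\<Sum>j\<in>A. c j * (LBINT t:{\<epsilon>..T}. g j t)) =
        (LBINT t:{\<epsilon>..T}. \<Sum>j\<in>A. c j * g j t)"
      using that by (auto simp: eventually_at_right_field eq intro!: exI[of _ T])
  qed
  moreover have "((\<lambda>T. \<Sum>j\<in>A. c j * G j T) \<longlongrightarrow> (\<Sum>j\<in>A. c j * I j)) at_top"
    by (intro tendsto_intros GI)
  ultimately show ?thesis
    unfolding has_integral_0_inf_minus_def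
    using ints by (intro conjI exI[of _ "\<lambda>T. \<Sum>j\<in>A. c j * G j T"]) auto
qed

section \<open>The sine integral\<close>

lemma Si_0 [simp]: "Si 0 = 0"
  using Si_neg[of 0] by simp

lemma Si_mult_at_top: "((\<lambda>u. Si (u * y)) \<longlongrightarrow> pi / 2 * sgn y) at_top"
proof -
  have pos: "((\<lambda>u. Si (u * y)) \<longlongrightarrow> pi / 2) at_top" if "y > 0" for y
    using that
    by (intro filterlim_compose[OF Si_at_top] filterlim_at_top_mult_tendsto_pos[OF tendsto_const])
       (auto simp: filterlim_ident)
  consider "y = 0" | "y > 0" | "y < 0" by linarith
  then show ?thesis
  proof cases
    case 3
    have "((\<lambda>u. - Si (u * (- y))) \<longlongrightarrow> - (pi / 2)) at_top"
      using 3 by (intro tendsto_minus pos) auto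
    moreover have "\<forall>\<^sub>F u in at_top. - Si (u * (- y)) = Si (u * y)"
      \<comment> \<open>\<open>Si_neg\<close> asks for a nonnegative argument, and
        \<open>u * (- y)\<close> is one as soon as \<open>u \<ge> 0\<close>.\<close>
      using eventually_ge_at_top[of 0]
    proof eventually_elim
      case (elim u)
      then have "Si (- (u * (- y))) = - Si (u * (- y))"
        using 3 by (intro Si_neg mult_nonneg_nonneg) auto
      then show ?case by simp
    qed
    ultimately show ?thesis
      using 3 by (auto intro: Lim_transform_eventually)
  qed (use pos in auto)
qed

lemma LBINT_sin_mult_divide:
  assumes "0 < \<epsilon>" "\<epsilon> \<le> T"
  shows "(LBINT t:{\<epsilon>..T}. sin (t * y) / t) = Si (T * y) - Si (\<epsilon> * y)"
  unfolding set_lebesgue_integral_def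
proof (rule integral_FTC_atLeastAtMost)
  fix t assume t: "\<epsilon> \<le> t" "t \<le> T"
  have "((\<lambda>t. Si (t * y)) has_real_derivative sinc (t * y) * y) (at t)"
    by (rule DERIV_chain2[OF DERIV_Si]) (auto intro!: derivative_eq_intros)
  \<comment> \<open>For \<open>y = 0\<close> both sides vanish, although \<open>sinc 0 = 1\<close>;
    otherwise \<open>t * y\<close> is nonzero and \<open>y\<close> cancels.\<close>
  also have "sinc (t * y) * y = sin (t * y) / t"
    using t assms by auto
  finally show "((\<lambda>t. Si (t * y)) has_vector_derivative sin (t * y) / t) (at t within {\<epsilon>..T})"
    by (simp add: has_real_derivative_iff_has_vector_derivative has_vector_derivative_at_within)
qed (use assms in \<open>auto intro!: continuous_intros\<close>)

section \<open>Sine expectations under a probability law on the line\<close>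

context real_distribution
begin

lemma char_diff_minus:
  "char M t - char M (- t) = 2 * \<i> * of_real (LINT y|M. sin (t * y))"
proof -
  have "char M t - char M (- t) = (CLINT y|M. iexp (t * y) - iexp (- t * y))"
    unfolding char_def
    by (intro Bochner_Integration.integral_diff [symmetric] integrable_iexp) auto
  also have "\<dots> = (CLINT y|M. 2 * \<i> * of_real (sin (t * y)))"
    by (intro Bochner_Integration.integral_cong)
       (auto simp: complex_eq_iff Re_exp Im_exp)
  also have "\<dots> = 2 * \<i> * of_real (LINT y|M. sin (t * y))"
    by (simp only: integral_mult_right_zero integral_complex_of_real)
  finally show ?thesis .
qed

text \<open>Both claims come from one use of Fubini on
  \<open>{\<epsilon>..T} \<times> space M\<close>: the set has finite measure, and the cutoff bounds
  the integrand by \<open>1 / \<epsilon>\<close> there.\<close>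

lemma
  assumes "0 < \<epsilon>" "\<epsilon> \<le> T"
  shows set_integrable_expectation_sin:
      "set_integrable lborel {\<epsilon>..T} (\<lambda>t. (LINT y|M. sin (t * y)) / t)" (is ?int)
    and LBINT_expectation_sin:
      "(LBINT t:{\<epsilon>..T}. (LINT y|M. sin (t * y)) / t) =
        (LINT y|M. Si (T * y)) - (LINT y|M. Si (\<epsilon> * y))" (is ?eq)
proof -
  interpret P: pair_sigma_finite lborel M ..
  let ?f = "\<lambda>(t, y). indicator ({\<epsilon>..T} \<times> space M) (t, y) *\<^sub>R (sin (t * y) / t)"
  obtain B where B: "\<And>t. \<bar>Si t\<bar> \<le> B" using bounded_Si by auto
  have int_Si: "integrable M (\<lambda>y. Si (u * y))" for u
    by (rule integrable_const_bound[of _ B]) (auto simp: B)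
  have bound: "\<bar>sin (t * y) / t\<bar> \<le> 1 / \<epsilon>" if "\<epsilon> \<le> t" for t y
    using that assms by (auto simp: abs_divide intro!: frac_le)
  have f: "integrable (lborel \<Otimes>\<^sub>M M) ?f"
    unfolding split_beta' prod.collapse
  proof (rule integrableI_bounded_set_indicator[where B = "1 / \<epsilon>"])
    show "emeasure (lborel \<Otimes>\<^sub>M M) ({\<epsilon>..T} \<times> space M) < \<infinity>"
      using assms emeasure_space_1
      by (subst emeasure_pair_measure_Times) (auto simp: ennreal_mult_less_top)
    show "{\<epsilon>..T} \<times> space M \<in> sets (lborel \<Otimes>\<^sub>M M)"
      by (intro pair_measureI sets.top) simp
  qed (use bound in auto)
  have inner: "(LINT y|M. ?f (t, y)) = indicator {\<epsilon>..T} t *\<^sub>R ((LINT y|M. sin (t * y)) / t)" for t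
    by (auto simp: indicator_def)
  show ?int
    using P.integrable_fst'[OF f] unfolding set_integrable_def inner .
  have "(LBINT t:{\<epsilon>..T}. (LINT y|M. sin (t * y)) / t) = (LINT t|lborel. (LINT y|M. ?f (t, y)))"
    unfolding set_lebesgue_integral_def inner ..
  also have "\<dots> = (LINT y|M. (LINT t|lborel. ?f (t, y)))"
    using P.Fubini_integral[of "\<lambda>t y. ?f (t, y)"] f by simp
  also have "\<dots> = (LINT y|M. (LBINT t:{\<epsilon>..T}. sin (t * y) / t))"
    by (intro Bochner_Integration.integral_cong)
       (auto simp: set_lebesgue_integral_def indicator_times)
  also have "\<dots> = (LINT y|M. Si (T * y) - Si (\<epsilon> * y))"
    using assms by (simp add: LBINT_sin_mult_divide)
  also have "\<dots> = (LINT y|M. Si (T * y)) - (LINT y|M. Si (\<epsilon> * y))"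
    by (intro Bochner_Integration.integral_diff int_Si)
  finally show ?eq .
qed

text \<open>\<open>Si\<close> is bounded and \<open>M\<close> has mass 1, so a constant
  dominates.\<close>

lemma expectation_Si_at_top:
  "((\<lambda>u. LINT y|M. Si (u * y)) \<longlongrightarrow> pi / 2 * (LINT y|M. sgn y)) at_top"
proof -
  obtain B where B: "\<And>t. \<bar>Si t\<bar> \<le> B" using bounded_Si by auto
  have "((\<lambda>u. LINT y|M. Si (u * y)) \<longlongrightarrow> (LINT y|M. pi / 2 * sgn y)) at_top"
    by (rule integral_dominated_convergence_at_top[where w = "\<lambda>_. B"])
       (use Si_mult_at_top in \<open>auto simp: B\<close>)
  then show ?thesis
    by simp
qed

text \<open>This limit removes the lower cutoff. It rests on the boundedness of \<open>Si\<close>,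
  its continuity and \<open>Si 0 = 0\<close>, rather than on absolute integrability of the sine
  integrand near 0. Passing from \<open>u\<close> to \<open>inverse u\<close> turns it into a limit
  along \<open>at_top\<close>, as the dominated convergence theorem used here expects.\<close>

lemma expectation_Si_at_0: "((\<lambda>u. LINT y|M. Si (u * y)) \<longlongrightarrow> 0) (at_right 0)"
  unfolding filterlim_at_right_to_top
proof -
  obtain B where B: "\<And>t. \<bar>Si t\<bar> \<le> B" using bounded_Si by auto
  have "((\<lambda>u. Si (inverse u * y)) \<longlongrightarrow> Si (0 * y)) at_top" for y
    by (intro isCont_tendsto_compose[OF isCont_Si] tendsto_intros
        tendsto_inverse_0_at_top filterlim_ident)
  then have "((\<lambda>u. LINT y|M. Si (inverse u * y)) \<longlongrightarrow> (LINT y|M. 0)) at_top"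
    by (intro integral_dominated_convergence_at_top[where w = "\<lambda>_. B"]) (auto simp: B)
  then show "((\<lambda>u. LINT y|M. Si (inverse u * y)) \<longlongrightarrow> 0) at_top"
    by simp
qed

text \<open>The factor \<open>c\<close> is moved into the law by passing to the image of
  \<open>M\<close> under multiplication by \<open>c\<close>. Since \<open>c > 0\<close>, this leaves
  the expectation of \<open>sgn\<close> unchanged, so the value is the same for every
  \<open>c\<close>.\<close>

lemma has_integral_0_inf_minus_expectation_sin:
  assumes "c > 0"
  shows "has_integral_0_inf_minus (\<lambda>t. of_real ((LINT y|M. sin (c * t * y)) / t))
    (of_real (pi / 2 * (LINT y|M. sgn y)))"
proof -
  interpret D: real_distribution "distr M borel ((*) c)"
    by (rule real_distribution_distr) simp
  define h where "h u = (LINT y|distr M borel ((*) c). Si (u * y))" for u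
  have sin_c: "(LINT y|distr M borel ((*) c). sin (t * y)) = (LINT y|M. sin (c * t * y))" for t
    by (subst integral_distr) (auto simp: mult_ac)
  have sgn_c: "(LINT y|distr M borel ((*) c). sgn y) = (LINT y|M. sgn y)"
    using assms by (subst integral_distr) (auto simp: sgn_mult)
  note int = D.set_integrable_expectation_sin [unfolded sin_c]
  have eq: "(LBINT t:{\<epsilon>..T}. of_real ((LINT y|M. sin (c * t * y)) / t)) =
      complex_of_real (h T - h \<epsilon>)"
    if "0 < \<epsilon>" "\<epsilon> \<le> T" for \<epsilon> T
    using D.LBINT_expectation_sin [OF that, unfolded sin_c, folded h_def]
    by (simp only: set_integral_complex_of_real)
  have "((\<lambda>\<epsilon>. LBINT t:{\<epsilon>..T}. of_real ((LINT y|M. sin (c * t * y)) / t)) \<longlongrightarrow>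
      complex_of_real (h T)) (at_right 0)" if "T > 0" for T
  proof (rule Lim_transform_eventually)
    show "((\<lambda>\<epsilon>. complex_of_real (h T - h \<epsilon>)) \<longlongrightarrow> complex_of_real (h T)) (at_right 0)"
      using D.expectation_Si_at_0 unfolding h_def by (auto intro!: tendsto_eq_intros)
    show "\<forall>\<^sub>F \<epsilon> in at_right 0. complex_of_real (h T - h \<epsilon>) =
        (LBINT t:{\<epsilon>..T}. of_real ((LINT y|M. sin (c * t * y)) / t))"
      using that by (simp only: eventually_at_right_field) (auto simp: eq simp del: of_real_divide of_real_diff)
  qed
  moreover have "((\<lambda>T. complex_of_real (h T)) \<longlongrightarrow> of_real (pi / 2 * (LINT y|M. sgn y))) at_top"
    using D.expectation_Si_at_top unfolding h_def sgn_c by (intro tendsto_of_real)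
  moreover have "set_integrable lborel {\<epsilon>..T}
      (\<lambda>t. complex_of_real ((LINT y|M. sin (c * t * y)) / t))" if "0 < \<epsilon>" "\<epsilon> \<le> T" for \<epsilon> T
    using int [OF that] by (simp only: set_integrable_def scaleR_conv_of_real
      of_real_mult [symmetric] complex_of_real_integrable_eq) simp
  ultimately show ?thesis
    unfolding has_integral_0_inf_minus_def
    by (intro conjI exI[of _ "\<lambda>T. complex_of_real (h T)"]) auto
qed

text \<open>The weight of the atom at 0, half that of the negative axis, reflects
  \<open>sgn 0 = 0\<close>.\<close>

lemma expectation_sgn: "(LINT y|M. sgn y) = 1 - (2 * prob {..<0} + prob {0})"
proof -
  have "(LINT y|M. sgn y) = (LINT y|M. 1 - (2 * indicator {..<0} y + indicator {0} y))"
    by (intro Bochner_Integration.integral_cong) (auto simp: indicator_def sgn_if)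
  also have "\<dots> = 1 - (2 * prob {..<0} + prob {0})"
    using prob_space by (simp add: integrable_const_bound[of _ 1])
  finally show ?thesis .
qed

end

section \<open>The inversion formula\<close>

theorem corollary3p8:
  fixes M :: "'a measure" and X :: "'a \<Rightarrow> real" and x :: real and m :: nat
    and f f\<^sub>x :: "real \<Rightarrow> complex"
  assumes "prob_space M"
    and "X \<in> borel_measurable M"
    and "f = char (distr M borel X)"
    and "f\<^sub>x = char (distr M borel (\<lambda>\<omega>. X \<omega> - x))"
  shows "(\<forall>t. f\<^sub>x t = exp (- (\<i> * of_real t * of_real x)) * f t) \<and>
    (\<exists>I. has_integral_0_inf_minus
            (\<lambda>t. (sym_diff_op t ^^ (2 * m + 1)) f\<^sub>x 0 / of_real t) I \<and>
         complex_of_real (\<P>(\<omega> in M. X \<omega> < x) + 1 / 2 * \<P>(\<omega> in M. X \<omega> = x)) =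
           1 / 2 - (-1) ^ m / (2 * of_real pi * \<i> * of_nat ((2 * m) choose m)) * I)"
proof -
  interpret prob_space M by fact
  note [measurable] = \<open>X \<in> borel_measurable M\<close>
  define N where "N = distr M borel (\<lambda>\<omega>. X \<omega> - x)"
  interpret N: real_distribution N
    unfolding N_def by (rule real_distribution_distr) simp
  \<comment> \<open>\<open>c j\<close> is \<open>n - 2 * j\<close> for \<open>n = 2 * m + 1\<close>,
    hence at least 1 for \<open>j \<le> m\<close>. The factor \<open>2 * \<i>\<close> in
    \<open>a j\<close> comes from \<open>N.char_diff_minus\<close>.\<close>
  define c where "c j = 2 * (real m - real j) + 1" for j
  define a where "a j = 2 * \<i> * ((-1) ^ j * of_nat ((2 * m + 1) choose j))" for j
  define S where "S = (LINT y|N. sgn y)"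
  define I where "I = (\<Sum>j\<le>m. a j * of_real (pi / 2 * S))"
  have shift: "f\<^sub>x t = exp (- (\<i> * of_real t * of_real x)) * f t" for t
  proof -
    have "f\<^sub>x t = (CLINT \<omega>|M. iexp (t * (X \<omega> - x)))"
      unfolding assms(4) char_def by (subst integral_distr) auto
    also have "\<dots> = (CLINT \<omega>|M. exp (- (\<i> * of_real t * of_real x)) * iexp (t * X \<omega>))"
      by (simp add: algebra_simps flip: exp_add)
    also have "\<dots> = exp (- (\<i> * of_real t * of_real x)) * f t"
      unfolding assms(3) char_def by (subst integral_distr) auto
    finally show ?thesis .
  qed
  have "has_integral_0_inf_minus (\<lambda>t. \<Sum>j\<le>m. a j * of_real ((LINT y|N. sin (c j * t * y)) / t)) I"
    unfolding I_def S_def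
    by (intro has_integral_0_inf_minus_sum N.has_integral_0_inf_minus_expectation_sin)
       (auto simp: c_def)
  also have "(\<lambda>t. \<Sum>j\<le>m. a j * of_real ((LINT y|N. sin (c j * t * y)) / t)) =
      (\<lambda>t. (sym_diff_op t ^^ (2 * m + 1)) f\<^sub>x 0 / of_real t)"
    unfolding assms(4) N_def [symmetric] sym_diff_op_funpow_odd N.char_diff_minus
    by (simp add: a_def c_def sum_divide_distrib mult_ac)
  finally have int: "has_integral_0_inf_minus
      (\<lambda>t. (sym_diff_op t ^^ (2 * m + 1)) f\<^sub>x 0 / of_real t) I" .
  \<comment> \<open>An alternating partial sum of a binomial row collapses to one signed coefficient
    of the row above, here row \<open>2 * m\<close>.\<close>
  have "(\<Sum>j\<le>m. (-1) ^ j * complex_of_nat ((2 * m + 1) choose j)) =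
      (-1) ^ m * of_nat ((2 * m) choose m)"
    using gbinomial_sum_lower_neg[of "of_nat (2 * m + 1) :: complex" m]
    by (simp only: binomial_gbinomial) (simp add: mult.commute)
  then have "I = 2 * \<i> * ((-1) ^ m * of_nat ((2 * m) choose m)) * of_real (pi / 2 * S)"
    unfolding I_def a_def sum_distrib_right [symmetric] sum_distrib_left [symmetric] by simp
  then have I: "I = \<i> * of_real pi * of_real S * ((-1) ^ m * of_nat ((2 * m) choose m))"
    by simp
  \<comment> \<open>The two signs \<open>(-1) ^ m\<close> multiply to 1, and the nonzero central
    binomial coefficient cancels.\<close>
  have "(-1) ^ m / (2 * of_real pi * \<i> * of_nat ((2 * m) choose m)) * I = of_real (S / 2)"
    by (simp add: I field_simps flip: power_mult_distrib)
  moreover have "S = 1 - (2 * \<P>(\<omega> in M. X \<omega> < x) + \<P>(\<omega> in M. X \<omega> = x))"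
  proof -
    have "N.prob {..<0} = \<P>(\<omega> in M. X \<omega> < x)" "N.prob {0} = \<P>(\<omega> in M. X \<omega> = x)"
      unfolding N_def by (auto simp: measure_distr intro!: arg_cong[where f = prob])
    then show ?thesis
      by (simp add: S_def N.expectation_sgn)
  qed
  ultimately have "complex_of_real (\<P>(\<omega> in M. X \<omega> < x) + 1 / 2 * \<P>(\<omega> in M. X \<omega> = x)) =
      1 / 2 - (-1) ^ m / (2 * of_real pi * \<i> * of_nat ((2 * m) choose m)) * I"
    by (simp only: diff_divide_distrib add_divide_distrib
        of_real_add of_real_diff of_real_divide of_real_mult) simp
  with shift int show ?thesis
    by blast
qed

end
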